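(* Let $\mathbb{K}=\mathbb{R}$ or $\mathbb{C}$, let $n\geq 1$, and let $\mathcal{G}$ be an abelian subgroup of $GL(n,\mathbb{K})$. Let $U$ be a $\mathcal{G}$-invariant dense open set in $\mathbb{K}^n$ such that every orbit of $\mathcal{G}$ contained in $U$ is minimal in $U$ and such that $\mathbb{K}^n-U$ is a union of at most $n$ $\mathcal{G}$-invariant vector subspaces of $\mathbb{K}^n$ of dimension $n-1$ or $n-2$ over $\mathbb{K}$. If $\mathcal{G}$ has a dense orbit in $\mathbb{K}^n$, then every orbit in $U$ is dense in $\mathbb{K}^n$.
   Context: $\mathcal{G}$ acts linearly on $\mathbb{K}^n$ by $(A,v)\mapsto Av$, and the orbit of $v$ is $\mathcal{G}(v)=\{Av: A\in\mathcal{G}\}$. A subset of $\mathbb{K}^n$ is $\mathcal{G}$-invariant if it is a union of orbits. If $V$ is a $\mathcal{G}$-invariant open set, a minimal set in $V$ is a non-empty $\mathcal{G}$-invariant subset of $V$, closed in $V$, with no proper subset having these properties; an orbit $O\subset V$ is minimal in $V$ if $\overline{O}\cap V$ is a minimal set in $V$. (A set $U$ with the listed properties exists for every abelian subgroup $\mathcal{G}$ of $GL(n,\mathbb{K})$.) *)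

theory Defs
  imports "HOL-Analysis.Analysis" "HOL-Algebra.Group"
begin

definition GL :: "('k::field ^ 'n ^ 'n) monoid" where
  "GL = \<lparr>carrier = {A. invertible A}, monoid.mult = (**), one = mat 1\<rparr>"

lemma group_GL: "group (GL :: ('k::field ^ 'n ^ 'n) monoid)"
proof (rule groupI)
  fix A B :: "'k ^ 'n ^ 'n" assume "A \<in> carrier GL" "B \<in> carrier GL"
  then show "A \<otimes>\<^bsub>GL\<^esub> B \<in> carrier GL"
    by (simp add: GL_def invertible_mult)
next
  fix A :: "'k ^ 'n ^ 'n" assume "A \<in> carrier GL"
  then show "\<exists>B\<in>carrier GL. B \<otimes>\<^bsub>GL\<^esub> A = \<one>\<^bsub>GL\<^esub>"
    by (auto simp: GL_def invertible_def)
qed (auto simp: GL_def matrix_mul_assoc invertible_def intro: exI[of _ "mat 1"])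

definition abelian_linear_group :: "('k::field ^ 'n ^ 'n) set \<Rightarrow> bool" where
  "abelian_linear_group G \<longleftrightarrow> subgroup G GL \<and> comm_group (GL\<lparr>carrier := G\<rparr>)"

definition orbit :: "('k::field ^ 'n ^ 'n) set \<Rightarrow> 'k ^ 'n \<Rightarrow> ('k ^ 'n) set" where
  "orbit G v = {A *v v | A. A \<in> G}"

definition invariant :: "('k::field ^ 'n ^ 'n) set \<Rightarrow> ('k ^ 'n) set \<Rightarrow> bool" where
  "invariant G X \<longleftrightarrow> (\<exists>S. X = (\<Union>v\<in>S. orbit G v))"

definition closed_invariant_in ::
    "('k::real_normed_field ^ 'n ^ 'n) set \<Rightarrow> ('k ^ 'n) set \<Rightarrow> ('k ^ 'n) set \<Rightarrow> bool" where
  "closed_invariant_in G V M \<longleftrightarrow>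
     M \<noteq> {} \<and> invariant G M \<and> M \<subseteq> V \<and> closedin (top_of_set V) M"

text \<open>The next two notions are meant for an open invariant set \<open>V\<close>.\<close>

definition minimal_set_in ::
    "('k::real_normed_field ^ 'n ^ 'n) set \<Rightarrow> ('k ^ 'n) set \<Rightarrow> ('k ^ 'n) set \<Rightarrow> bool" where
  "minimal_set_in G V M \<longleftrightarrow>
     closed_invariant_in G V M \<and> \<not> (\<exists>N. N \<subset> M \<and> closed_invariant_in G V N)"

definition minimal_orbit_in ::
    "('k::real_normed_field ^ 'n ^ 'n) set \<Rightarrow> ('k ^ 'n) set \<Rightarrow> ('k ^ 'n) set \<Rightarrow> bool" where
  "minimal_orbit_in G V Ob \<longleftrightarrow> Ob \<subseteq> V \<and> minimal_set_in G V (closure Ob \<inter> V)"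

text \<open>
  Subspaces and dimensions are over the field of scalars \<open>'k\<close>, i.e. with respect to \<open>(*s)\<close>,
  and not over the reals. The dimensions \<open>n - 1\<close> and \<open>n - 2\<close> are written additively because
  subtraction on \<open>nat\<close> truncates.
\<close>

definition union_of_invariant_subspaces ::
    "('k::field ^ 'n ^ 'n) set \<Rightarrow> ('k ^ 'n) set \<Rightarrow> bool" where
  "union_of_invariant_subspaces G X \<longleftrightarrow>
     (\<exists>F. finite F \<and> card F \<le> CARD('n) \<and> X = \<Union>F \<and>
        (\<forall>W\<in>F. invariant G W \<and> vec.subspace W \<and>
           (vec.dim W + 1 = CARD('n) \<or> vec.dim W + 2 = CARD('n))))"

end

theory Submission imports Defs begin

text \<open>
  The dense orbit meets the nonempty open set \<open>U\<close>, and since the orbits of a group are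
  disjoint or equal and \<open>U\<close> is a union of orbits, it lies inside \<open>U\<close>. Minimality of this orbit then says that \<open>U\<close> itself is a minimal set
  in \<open>U\<close>. For any other orbit \<open>O\<close> in \<open>U\<close>, minimality of \<open>O\<close> gives that \<open>closure O \<inter> U\<close> is
  a closed invariant set of \<open>U\<close>, so by minimality of \<open>U\<close> it is all of \<open>U\<close>; hence \<open>closure O\<close>
  contains \<open>closure U\<close>, which is the whole space. The argument is the same over both fields, so it
  is carried out once over an arbitrary real normed field.
\<close>

lemma orbit_subset_of_mem_orbit:
  fixes G :: "('k::field ^ 'n ^ 'n) set"
  assumes "subgroup G GL" and "x \<in> orbit G s"
  shows "orbit G x \<subseteq> orbit G s"
proof -
  obtain B where "B \<in> G" and x: "x = B *v s"
    using assms(2) by (auto simp: orbit_def)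
  moreover have "C ** B \<in> G" if "C \<in> G" for C
    using subgroup.m_closed[OF assms(1) that \<open>B \<in> G\<close>] by (simp add: GL_def)
  ultimately show ?thesis
    unfolding orbit_def by (auto simp: matrix_vector_mul_assoc)
qed

lemma mem_orbit_sym:
  fixes G :: "('k::field ^ 'n ^ 'n) set"
  assumes "subgroup G GL" and "x \<in> orbit G v"
  shows "v \<in> orbit G x"
proof -
  obtain A where "A \<in> G" and x: "x = A *v v"
    using assms(2) by (auto simp: orbit_def)
  let ?B = "inv\<^bsub>GL\<^esub> A"
  have "A \<in> carrier GL"
    using subgroup.mem_carrier[OF assms(1) \<open>A \<in> G\<close>] .
  then have "?B ** A = mat 1"
    using group.l_inv[OF group_GL] by (simp add: GL_def)
  then have "v = ?B *v x"
    by (simp add: x matrix_vector_mul_assoc)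
  moreover have "?B \<in> G"
    using subgroup.m_inv_closed[OF assms(1) \<open>A \<in> G\<close>] .
  ultimately show ?thesis
    by (auto simp: orbit_def)
qed

lemma orbit_subset_invariant_if_meets:
  fixes G :: "('k::field ^ 'n ^ 'n) set"
  assumes "subgroup G GL" and "invariant G U" and "orbit G v \<inter> U \<noteq> {}"
  shows "orbit G v \<subseteq> U"
proof -
  obtain x s where "x \<in> orbit G v" and xs: "x \<in> orbit G s" and sU: "orbit G s \<subseteq> U"
    using assms(2,3) unfolding invariant_def by blast
  then have "v \<in> orbit G x"
    using mem_orbit_sym[OF assms(1)] by blast
  then have "orbit G v \<subseteq> orbit G x"
    by (rule orbit_subset_of_mem_orbit[OF assms(1)])
  also have "\<dots> \<subseteq> orbit G s"
    by (rule orbit_subset_of_mem_orbit[OF assms(1) xs])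
  finally show ?thesis
    using sU by simp
qed

lemma orbits_dense_if_minimal_and_dense_orbit:
  fixes G :: "('k::real_normed_field ^ 'n ^ 'n) set"
  assumes G: "subgroup G GL"
    and U: "invariant G U" "open U" "closure U = UNIV"
    and minimal: "\<And>v. orbit G v \<subseteq> U \<Longrightarrow> minimal_orbit_in G U (orbit G v)"
    and dense: "closure (orbit G v) = UNIV"
    and w: "orbit G w \<subseteq> U"
  shows "closure (orbit G w) = UNIV"
proof -
  have "U \<noteq> {}"
    using U(3) by auto
  then have "orbit G v \<inter> U \<noteq> {}"
    using open_Int_closure_eq_empty[OF U(2), of "orbit G v"] dense by auto
  then have "orbit G v \<subseteq> U"
    by (rule orbit_subset_invariant_if_meets[OF G U(1)])
  from minimal[OF this] have "minimal_set_in G U U"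
    by (simp add: minimal_orbit_in_def dense)
  moreover have "closed_invariant_in G U (closure (orbit G w) \<inter> U)"
    using minimal[OF w] by (simp add: minimal_orbit_in_def minimal_set_in_def)
  ultimately have "U \<subseteq> closure (orbit G w)"
    unfolding minimal_set_in_def by blast
  then have "closure U \<subseteq> closure (orbit G w)"
    by (simp add: closure_minimal)
  then show ?thesis
    using U(3) by auto
qed

theorem corollary1p5:
  shows "(\<forall>(G :: (real ^ 'n ^ 'n) set) (U :: (real ^ 'n) set).
        abelian_linear_group G \<longrightarrow>
        invariant G U \<longrightarrow> open U \<longrightarrow> closure U = UNIV \<longrightarrow>
        (\<forall>v. orbit G v \<subseteq> U \<longrightarrow> minimal_orbit_in G U (orbit G v)) \<longrightarrow>
        union_of_invariant_subspaces G (UNIV - U) \<longrightarrow>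
        (\<exists>v. closure (orbit G v) = UNIV) \<longrightarrow>
        (\<forall>v. orbit G v \<subseteq> U \<longrightarrow> closure (orbit G v) = UNIV))
    \<and>
     (\<forall>(G :: (complex ^ 'n ^ 'n) set) (U :: (complex ^ 'n) set).
        abelian_linear_group G \<longrightarrow>
        invariant G U \<longrightarrow> open U \<longrightarrow> closure U = UNIV \<longrightarrow>
        (\<forall>v. orbit G v \<subseteq> U \<longrightarrow> minimal_orbit_in G U (orbit G v)) \<longrightarrow>
        union_of_invariant_subspaces G (UNIV - U) \<longrightarrow>
        (\<exists>v. closure (orbit G v) = UNIV) \<longrightarrow>
        (\<forall>v. orbit G v \<subseteq> U \<longrightarrow> closure (orbit G v) = UNIV))"
  unfolding abelian_linear_group_def
  by (intro conjI allI impI;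
      elim conjE exE; rule orbits_dense_if_minimal_and_dense_orbit; (assumption | simp))

end
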